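(* The logic sBIL is implicative: for all propositional variables $p,q,r$ the following hold: (IL1) $\vdash_s p\to p$; (IL2) $p\to q,\ q\to r\vdash_s p\to r$; (IL3) for every connective $\lambda\in\{\top,\bot,\wedge,\vee,\to,\prec\}$ of arity $n$ and variables $p_1,\dots,p_n,q_1,\dots,q_n$: $\{p_k\to q_k\mid 1\le k\le n\}\cup\{q_k\to p_k\mid 1\le k\le n\}\vdash_s \lambda p_1\dots p_n\to\lambda q_1\dots q_n$; (IL4) $p,\ p\to q\vdash_s q$; (IL5) $p\vdash_s q\to p$.
   Context: Fix a countably infinite set $\mathrm{Prop}$ of propositional variables. Bi-intuitionistic formulas are generated by $\phi ::= p \mid \bot \mid \top \mid \phi\wedge\phi \mid \phi\vee\phi \mid \phi\to\phi \mid \phi\prec\phi$ with $p\in\mathrm{Prop}$, where $\prec$ is the binary exclusion connective. Abbreviations: $\neg\phi := \phi\to\bot$, ${\sim}\phi := \top\prec\phi$, $\phi\leftrightarrow\psi := (\phi\to\psi)\wedge(\psi\to\phi)$. An axiom is any instance of: (A1) $\phi\to(\psi\to\phi)$; (A2) $(\phi\to(\psi\to\chi))\to((\phi\to\psi)\to(\phi\to\chi))$; (A3) $\phi\to(\phi\vee\psi)$; (A4) $\psi\to(\phi\vee\psi)$; (A5) $(\phi\to\chi)\to((\psi\to\chi)\to((\phi\vee\psi)\to\chi))$; (A6) $(\phi\wedge\psi)\to\phi$; (A7) $(\phi\wedge\psi)\to\psi$; (A8) $(\chi\to\phi)\to((\chi\to\psi)\to(\chi\to(\phi\wedge\psi)))$;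 (A9) $\bot\to\phi$; (A10) $\phi\to\top$; (A11) $\phi\to(\psi\vee(\phi\prec\psi))$; (A12) $(\phi\prec\psi)\to{\sim}(\phi\to\psi)$; (A13) $((\phi\prec\psi)\prec\chi)\to(\phi\prec(\psi\vee\chi))$; (A14) $\neg(\phi\prec\psi)\to(\phi\to\psi)$. The logic sBIL is the relation $\Gamma\vdash_s\phi$ (for a set of formulas $\Gamma$ and a formula $\phi$) that holds iff $\Gamma\vdash\phi$ is derivable with the rules: (Ax) $\Gamma\vdash\phi$ for any axiom $\phi$; (El) $\Gamma\vdash\phi$ if $\phi\in\Gamma$; (MP) from $\Gamma\vdash\phi$ and $\Gamma\vdash\phi\to\psi$ infer $\Gamma\vdash\psi$; (sDN) from $\Gamma\vdash\phi$ infer $\Gamma\vdash\neg{\sim}\phi$. We write $\vdash_s\phi$ for $\emptyset\vdash_s\phi$ and list finitely many premises separated by commas. *)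

theory Defs
  imports Main "HOL-Library.Countable" "HOL-Library.Infinite_Typeclass"
begin

datatype 'p form =
    Var 'p
  | Bot ("\<^bold>\<bottom>")
  | Top ("\<^bold>\<top>")
  | And "'p form" "'p form" (infixr "\<^bold>\<and>" 75)
  | Or "'p form" "'p form" (infixr "\<^bold>\<or>" 70)
  | Imp "'p form" "'p form" (infixr "\<^bold>\<rightarrow>" 65)
  | Excl "'p form" "'p form" (infixl "\<^bold>\<prec>" 75)

abbreviation Neg :: "'p form \<Rightarrow> 'p form" ("\<^bold>\<not> _" [80] 80) where
  "\<^bold>\<not> \<phi> \<equiv> \<phi> \<^bold>\<rightarrow> \<^bold>\<bottom>"

abbreviation CoNeg :: "'p form \<Rightarrow> 'p form" ("\<^bold>\<sim> _" [80] 80) where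
  "\<^bold>\<sim> \<phi> \<equiv> \<^bold>\<top> \<^bold>\<prec> \<phi>"

inductive_set axioms :: "'p form set" where
  A1: "\<phi> \<^bold>\<rightarrow> (\<psi> \<^bold>\<rightarrow> \<phi>) \<in> axioms"
| A2: "(\<phi> \<^bold>\<rightarrow> (\<psi> \<^bold>\<rightarrow> \<chi>)) \<^bold>\<rightarrow> ((\<phi> \<^bold>\<rightarrow> \<psi>) \<^bold>\<rightarrow> (\<phi> \<^bold>\<rightarrow> \<chi>)) \<in> axioms"
| A3: "\<phi> \<^bold>\<rightarrow> (\<phi> \<^bold>\<or> \<psi>) \<in> axioms"
| A4: "\<psi> \<^bold>\<rightarrow> (\<phi> \<^bold>\<or> \<psi>) \<in> axioms"
| A5: "(\<phi> \<^bold>\<rightarrow> \<chi>) \<^bold>\<rightarrow> ((\<psi> \<^bold>\<rightarrow> \<chi>) \<^bold>\<rightarrow> ((\<phi> \<^bold>\<or> \<psi>) \<^bold>\<rightarrow> \<chi>)) \<in> axioms"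
| A6: "(\<phi> \<^bold>\<and> \<psi>) \<^bold>\<rightarrow> \<phi> \<in> axioms"
| A7: "(\<phi> \<^bold>\<and> \<psi>) \<^bold>\<rightarrow> \<psi> \<in> axioms"
| A8: "(\<chi> \<^bold>\<rightarrow> \<phi>) \<^bold>\<rightarrow> ((\<chi> \<^bold>\<rightarrow> \<psi>) \<^bold>\<rightarrow> (\<chi> \<^bold>\<rightarrow> (\<phi> \<^bold>\<and> \<psi>))) \<in> axioms"
| A9: "\<^bold>\<bottom> \<^bold>\<rightarrow> \<phi> \<in> axioms"
| A10: "\<phi> \<^bold>\<rightarrow> \<^bold>\<top> \<in> axioms"
| A11: "\<phi> \<^bold>\<rightarrow> (\<psi> \<^bold>\<or> (\<phi> \<^bold>\<prec> \<psi>)) \<in> axioms"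
| A12: "(\<phi> \<^bold>\<prec> \<psi>) \<^bold>\<rightarrow> \<^bold>\<sim> (\<phi> \<^bold>\<rightarrow> \<psi>) \<in> axioms"
| A13: "((\<phi> \<^bold>\<prec> \<psi>) \<^bold>\<prec> \<chi>) \<^bold>\<rightarrow> (\<phi> \<^bold>\<prec> (\<psi> \<^bold>\<or> \<chi>)) \<in> axioms"
| A14: "\<^bold>\<not> (\<phi> \<^bold>\<prec> \<psi>) \<^bold>\<rightarrow> (\<phi> \<^bold>\<rightarrow> \<psi>) \<in> axioms"

inductive sBIL :: "'p form set \<Rightarrow> 'p form \<Rightarrow> bool" (infix "\<turnstile>\<^sub>s" 50)
  for \<Gamma> :: "'p form set" where
  Ax: "\<phi> \<in> axioms \<Longrightarrow> \<Gamma> \<turnstile>\<^sub>s \<phi>"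
| El: "\<phi> \<in> \<Gamma> \<Longrightarrow> \<Gamma> \<turnstile>\<^sub>s \<phi>"
| MP: "\<Gamma> \<turnstile>\<^sub>s \<phi> \<Longrightarrow> \<Gamma> \<turnstile>\<^sub>s \<phi> \<^bold>\<rightarrow> \<psi> \<Longrightarrow> \<Gamma> \<turnstile>\<^sub>s \<psi>"
| sDN: "\<Gamma> \<turnstile>\<^sub>s \<phi> \<Longrightarrow> \<Gamma> \<turnstile>\<^sub>s \<^bold>\<not> (\<^bold>\<sim> \<phi>)"

datatype connective = CTop | CBot | CAnd | COr | CImp | CExcl

fun arity :: "connective \<Rightarrow> nat" where
  "arity CTop = 0"
| "arity CBot = 0"
| "arity CAnd = 2"
| "arity COr = 2"
| "arity CImp = 2"
| "arity CExcl = 2"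

text \<open>Only meaningful on argument lists whose length is the arity of the connective.\<close>

fun app :: "connective \<Rightarrow> 'p form list \<Rightarrow> 'p form" where
  "app CTop [] = \<^bold>\<top>"
| "app CBot [] = \<^bold>\<bottom>"
| "app CAnd [\<phi>, \<psi>] = \<phi> \<^bold>\<and> \<psi>"
| "app COr [\<phi>, \<psi>] = \<phi> \<^bold>\<or> \<psi>"
| "app CImp [\<phi>, \<psi>] = \<phi> \<^bold>\<rightarrow> \<psi>"
| "app CExcl [\<phi>, \<psi>] = \<phi> \<^bold>\<prec> \<psi>"

end

theory Submission
  imports Defs
begin

text \<open>
  All conditions except congruence for exclusion hold already for the intuitionistic fragment.
  For exclusion the point is that \<open>\<^bold>\<prec>\<close> is left residual to \<open>\<^bold>\<or>\<close>: from \<open>\<phi> \<^bold>\<rightarrow> \<psi> \<^bold>\<or> \<chi>\<close> the rule (sDN)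
  gives \<open>\<^bold>\<not> \<^bold>\<sim> (\<phi> \<^bold>\<rightarrow> \<psi> \<^bold>\<or> \<chi>)\<close>, which (A12) and (A13) turn into \<open>\<^bold>\<not> ((\<phi> \<^bold>\<prec> \<psi>) \<^bold>\<prec> \<chi>)\<close>, and (A14)
  yields \<open>\<phi> \<^bold>\<prec> \<psi> \<^bold>\<rightarrow> \<chi>\<close>. Together with (A11) this makes exclusion monotone in its first and
  antitone in its second argument.
\<close>

lemma sBIL_imp_weaken: "\<Gamma> \<turnstile>\<^sub>s \<psi> \<Longrightarrow> \<Gamma> \<turnstile>\<^sub>s \<phi> \<^bold>\<rightarrow> \<psi>"
  by (rule MP[OF _ Ax[OF A1]])

text \<open>Modus ponens under a fixed antecedent, obtained from \<open>A2\<close>; it lets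
  derivations carry a hypothesis without a deduction theorem.\<close>

lemma sBIL_imp_MP:
  assumes "\<Gamma> \<turnstile>\<^sub>s \<phi> \<^bold>\<rightarrow> (\<psi> \<^bold>\<rightarrow> \<chi>)" and "\<Gamma> \<turnstile>\<^sub>s \<phi> \<^bold>\<rightarrow> \<psi>"
  shows "\<Gamma> \<turnstile>\<^sub>s \<phi> \<^bold>\<rightarrow> \<chi>"
  by (rule MP[OF assms(2) MP[OF assms(1) Ax[OF A2]]])

lemma sBIL_imp_refl: "\<Gamma> \<turnstile>\<^sub>s \<phi> \<^bold>\<rightarrow> \<phi>"
  \<comment> \<open>The combinator identity S K K = I; the instance of \<open>A1\<close> fixes the
    intermediate formula as \<phi> implies \<phi>.\<close>
  by (rule sBIL_imp_MP[OF Ax[OF A1] Ax[OF A1[of _ \<phi>]]])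

lemma sBIL_imp_trans:
  assumes "\<Gamma> \<turnstile>\<^sub>s \<phi> \<^bold>\<rightarrow> \<psi>" and "\<Gamma> \<turnstile>\<^sub>s \<psi> \<^bold>\<rightarrow> \<chi>"
  shows "\<Gamma> \<turnstile>\<^sub>s \<phi> \<^bold>\<rightarrow> \<chi>"
  by (rule sBIL_imp_MP[OF sBIL_imp_weaken[OF assms(2)] assms(1)])

lemma sBIL_conj_mono:
  assumes "\<Gamma> \<turnstile>\<^sub>s \<phi> \<^bold>\<rightarrow> \<phi>'" and "\<Gamma> \<turnstile>\<^sub>s \<psi> \<^bold>\<rightarrow> \<psi>'"
  shows "\<Gamma> \<turnstile>\<^sub>s \<phi> \<^bold>\<and> \<psi> \<^bold>\<rightarrow> \<phi>' \<^bold>\<and> \<psi>'"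
  by (rule MP[OF sBIL_imp_trans[OF Ax[OF A7] assms(2)]
        MP[OF sBIL_imp_trans[OF Ax[OF A6] assms(1)] Ax[OF A8]]])

lemma sBIL_disj_mono:
  assumes "\<Gamma> \<turnstile>\<^sub>s \<phi> \<^bold>\<rightarrow> \<phi>'" and "\<Gamma> \<turnstile>\<^sub>s \<psi> \<^bold>\<rightarrow> \<psi>'"
  shows "\<Gamma> \<turnstile>\<^sub>s \<phi> \<^bold>\<or> \<psi> \<^bold>\<rightarrow> \<phi>' \<^bold>\<or> \<psi>'"
  by (rule MP[OF sBIL_imp_trans[OF assms(2) Ax[OF A4]]
        MP[OF sBIL_imp_trans[OF assms(1) Ax[OF A3]] Ax[OF A5]]])

lemma sBIL_imp_mono:
  assumes "\<Gamma> \<turnstile>\<^sub>s \<phi>' \<^bold>\<rightarrow> \<phi>" and "\<Gamma> \<turnstile>\<^sub>s \<psi> \<^bold>\<rightarrow> \<psi>'"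
  shows "\<Gamma> \<turnstile>\<^sub>s (\<phi> \<^bold>\<rightarrow> \<psi>) \<^bold>\<rightarrow> (\<phi>' \<^bold>\<rightarrow> \<psi>')"
proof (rule sBIL_imp_trans)
  show "\<Gamma> \<turnstile>\<^sub>s (\<phi> \<^bold>\<rightarrow> \<psi>) \<^bold>\<rightarrow> (\<phi>' \<^bold>\<rightarrow> \<psi>)"
    \<comment> \<open>\<open>A1\<close> followed by \<open>A2\<close> internalises precomposition;
      the weakened assumption then supplies the map to precompose with.\<close>
    by (rule sBIL_imp_MP[OF sBIL_imp_trans[OF Ax[OF A1] Ax[OF A2]] sBIL_imp_weaken[OF assms(1)]])
  show "\<Gamma> \<turnstile>\<^sub>s (\<phi>' \<^bold>\<rightarrow> \<psi>) \<^bold>\<rightarrow> (\<phi>' \<^bold>\<rightarrow> \<psi>')"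
    by (rule MP[OF sBIL_imp_weaken[OF assms(2)] Ax[OF A2]])
qed

lemma sBIL_excl_residuation:
  assumes "\<Gamma> \<turnstile>\<^sub>s \<phi> \<^bold>\<rightarrow> \<psi> \<^bold>\<or> \<chi>"
  shows "\<Gamma> \<turnstile>\<^sub>s \<phi> \<^bold>\<prec> \<psi> \<^bold>\<rightarrow> \<chi>"
proof -
  have "\<Gamma> \<turnstile>\<^sub>s (\<phi> \<^bold>\<prec> \<psi>) \<^bold>\<prec> \<chi> \<^bold>\<rightarrow> \<^bold>\<sim> (\<phi> \<^bold>\<rightarrow> \<psi> \<^bold>\<or> \<chi>)"
    by (rule sBIL_imp_trans[OF Ax[OF A13] Ax[OF A12]])
  then have "\<Gamma> \<turnstile>\<^sub>s \<^bold>\<not> ((\<phi> \<^bold>\<prec> \<psi>) \<^bold>\<prec> \<chi>)"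
    \<comment> \<open>Negation is implication into \<open>Bot\<close>, so transitivity acts as
      contraposition here.\<close>
    using sDN[OF assms] by (rule sBIL_imp_trans)
  then show ?thesis
    by (rule MP[OF _ Ax[OF A14]])
qed

lemma sBIL_excl_mono:
  assumes "\<Gamma> \<turnstile>\<^sub>s \<phi> \<^bold>\<rightarrow> \<phi>'" and "\<Gamma> \<turnstile>\<^sub>s \<psi>' \<^bold>\<rightarrow> \<psi>"
  shows "\<Gamma> \<turnstile>\<^sub>s \<phi> \<^bold>\<prec> \<psi> \<^bold>\<rightarrow> \<phi>' \<^bold>\<prec> \<psi>'"
proof (rule sBIL_excl_residuation)
  \<comment> \<open>\<open>A11\<close> for the primed formulas is the unit of the residuation;
    antitonicity then comes from enlarging the left disjunct.\<close>
  have "\<Gamma> \<turnstile>\<^sub>s \<phi> \<^bold>\<rightarrow> \<psi>' \<^bold>\<or> (\<phi>' \<^bold>\<prec> \<psi>')"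
    by (rule sBIL_imp_trans[OF assms(1) Ax[OF A11]])
  then show "\<Gamma> \<turnstile>\<^sub>s \<phi> \<^bold>\<rightarrow> \<psi> \<^bold>\<or> (\<phi>' \<^bold>\<prec> \<psi>')"
    using sBIL_disj_mono[OF assms(2) sBIL_imp_refl] by (rule sBIL_imp_trans)
qed

text \<open>Both directions are assumed because implication is antitone in its first argument and
  exclusion in its second.\<close>

lemma sBIL_app_cong:
  assumes "length \<phi>s = arity c" and "length \<psi>s = arity c"
    and fwd: "\<And>k. k < arity c \<Longrightarrow> \<Gamma> \<turnstile>\<^sub>s \<phi>s ! k \<^bold>\<rightarrow> \<psi>s ! k"
    and bwd: "\<And>k. k < arity c \<Longrightarrow> \<Gamma> \<turnstile>\<^sub>s \<psi>s ! k \<^bold>\<rightarrow> \<phi>s ! k"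
  shows "\<Gamma> \<turnstile>\<^sub>s app c \<phi>s \<^bold>\<rightarrow> app c \<psi>s"
proof (cases "arity c = 0")
  case True
  \<comment> \<open>Both lists are empty, so the two sides coincide.\<close>
  with assms(1,2) show ?thesis
    by (simp add: sBIL_imp_refl)
next
  case False
  then have "arity c = 2"
    by (cases c) simp_all
  with assms(1,2) obtain \<phi> \<phi>' \<psi> \<psi>' where "\<phi>s = [\<phi>, \<phi>']" "\<psi>s = [\<psi>, \<psi>']"
    by (auto simp: numeral_2_eq_2 length_Suc_conv)
  with \<open>arity c = 2\<close> fwd[of 0] fwd[of 1] bwd[of 0] bwd[of 1] show ?thesis
    by (cases c) (simp_all add: sBIL_conj_mono sBIL_disj_mono sBIL_imp_mono sBIL_excl_mono)
qed

theorem mainTheorem1: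
  shows "(\<forall>p :: 'p :: {countable, infinite}. {} \<turnstile>\<^sub>s Var p \<^bold>\<rightarrow> Var p) \<and>
    (\<forall>p q r :: 'p. {Var p \<^bold>\<rightarrow> Var q, Var q \<^bold>\<rightarrow> Var r} \<turnstile>\<^sub>s Var p \<^bold>\<rightarrow> Var r) \<and>
    (\<forall>c. \<forall>ps qs :: 'p list. length ps = arity c \<longrightarrow> length qs = arity c \<longrightarrow>
      {Var (ps ! k) \<^bold>\<rightarrow> Var (qs ! k) | k. k < arity c} \<union>
      {Var (qs ! k) \<^bold>\<rightarrow> Var (ps ! k) | k. k < arity c}
        \<turnstile>\<^sub>s app c (map Var ps) \<^bold>\<rightarrow> app c (map Var qs)) \<and>
    (\<forall>p q :: 'p. {Var p, Var p \<^bold>\<rightarrow> Var q} \<turnstile>\<^sub>s Var q) \<and>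
    (\<forall>p q :: 'p. {Var p} \<turnstile>\<^sub>s Var q \<^bold>\<rightarrow> Var p)"
proof (intro conjI allI impI)
  fix p :: 'p
  show "{} \<turnstile>\<^sub>s Var p \<^bold>\<rightarrow> Var p"
    by (rule sBIL_imp_refl)
next
  fix p q r :: 'p
  show "{Var p \<^bold>\<rightarrow> Var q, Var q \<^bold>\<rightarrow> Var r} \<turnstile>\<^sub>s Var p \<^bold>\<rightarrow> Var r"
    by (rule sBIL_imp_trans[of _ _ "Var q"]) (simp_all add: El)
next
  fix c and ps qs :: "'p list"
  assume "length ps = arity c" "length qs = arity c"
  then show "{Var (ps ! k) \<^bold>\<rightarrow> Var (qs ! k) | k. k < arity c} \<union>
      {Var (qs ! k) \<^bold>\<rightarrow> Var (ps ! k) | k. k < arity c}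
        \<turnstile>\<^sub>s app c (map Var ps) \<^bold>\<rightarrow> app c (map Var qs)"
    \<comment> \<open>The lengths let \<open>map Var ps ! k\<close> become
      \<open>Var (ps ! k)\<close>, so every required implication is itself a premise.\<close>
    by (intro sBIL_app_cong) (auto intro!: El)
next
  fix p q :: 'p
  show "{Var p, Var p \<^bold>\<rightarrow> Var q} \<turnstile>\<^sub>s Var q"
    by (rule MP[of _ "Var p"]) (simp_all add: El)
next
  fix p q :: 'p
  show "{Var p} \<turnstile>\<^sub>s Var q \<^bold>\<rightarrow> Var p"
    by (simp add: sBIL_imp_weaken El)
qed

end
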